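(* Let $q$ be a power of $2$ and let \[ f(X)=X+\frac{1}{X-r}+\frac{1}{X-r^q}\in\mathbb{F}_q(X), \] where $r\in\mathbb{F}_{q^2}\setminus\mathbb{F}_q$. Then $f$ is a permutation rational function of $\mathbb{P}^1(\mathbb{F}_q)$ if and only if $r+r^q=1$.
   Context: $\mathbb{P}^1(\mathbb{F}_q)=\mathbb{F}_q\cup\{\infty\}$ is the projective line over $\mathbb{F}_q$. A rational function $f=P/Q\in\mathbb{F}_q(X)$ ($P,Q$ coprime) defines a map $\mathbb{P}^1(\mathbb{F}_q)\to\mathbb{P}^1(\mathbb{F}_q)$ in the usual way (zeros of $Q$ map to $\infty$, and $f(\infty)$ is the limiting value). A permutation rational function of $\mathbb{P}^1(\mathbb{F}_q)$ is a rational function whose induced map on $\mathbb{P}^1(\mathbb{F}_q)$ is a bijection. *)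

theory Defs
  imports "HOL-Computational_Algebra.Computational_Algebra" "HOL-Library.Cardinality"
begin

definition is_subfield :: "'a::field set \<Rightarrow> bool" where
  "is_subfield K \<longleftrightarrow>
     0 \<in> K \<and> 1 \<in> K \<and>
     (\<forall>x\<in>K. \<forall>y\<in>K. x - y \<in> K \<and> x * y \<in> K) \<and>
     (\<forall>x\<in>K. inverse x \<in> K)"

datatype 'a proj_line = Affine 'a | Infty

definition proj_line_over :: "'a set \<Rightarrow> 'a proj_line set" where
  "proj_line_over K = insert Infty (Affine ` K)"

text \<open>The subfield \<open>K(X)\<close> of the field \<open>'a(X)\<close> of rational functions.\<close>

definition ratfuns_over :: "'a::field set \<Rightarrow> 'a poly fract set" where
  "ratfuns_over K =
     {Fract P Q | P Q. Q \<noteq> 0 \<and> set (coeffs P) \<subseteq> K \<and> set (coeffs Q) \<subseteq> K}"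

text \<open>
  The map induced by \<open>P/Q\<close>, for coprime \<open>P\<close> and \<open>Q \<noteq> 0\<close>. If \<open>degree P \<le> degree Q\<close>, the
  limiting value at infinity is \<open>coeff P (degree Q) / lead_coeff Q\<close>: the quotient of the leading
  coefficients if the degrees agree, and \<open>0\<close> otherwise.
\<close>

definition quot_map :: "'a::field poly \<Rightarrow> 'a poly \<Rightarrow> 'a proj_line \<Rightarrow> 'a proj_line" where
  "quot_map P Q z = (case z of
       Affine x \<Rightarrow> if poly Q x = 0 then Infty else Affine (poly P x / poly Q x)
     | Infty \<Rightarrow> if degree P > degree Q then Infty else Affine (coeff P (degree Q) / lead_coeff Q))"

definition ratfun_map :: "'a::field poly fract \<Rightarrow> 'a proj_line \<Rightarrow> 'a proj_line" where
  "ratfun_map f =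
     (THE g. \<exists>P Q. Q \<noteq> 0 \<and> coprime P Q \<and> f = Fract P Q \<and> g = quot_map P Q)"

definition permutation_ratfun :: "'a::field set \<Rightarrow> 'a poly fract \<Rightarrow> bool" where
  "permutation_ratfun K f \<longleftrightarrow>
     f \<in> ratfuns_over K \<and> bij_betw (ratfun_map f) (proj_line_over K) (proj_line_over K)"

text \<open>
  The description in \<open>ratfun_map\<close> is definite: a representation in lowest terms exists and the
  induced map does not depend on it. The library's gcd-based normal form of fractions is not
  available for polynomials over an arbitrary type of class \<open>field\<close>.
\<close>

lemma poly_bezout:
  fixes P Q :: "'a::field poly"
  shows "\<exists>A B. A * P + B * Q dvd P \<and> A * P + B * Q dvd Q"
proof (induction "euclidean_size Q" arbitrary: P Q rule: less_induct)
  case less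
  show ?case
  proof (cases "Q = 0")
    case True
    then have "1 * P + 0 * Q dvd P \<and> 1 * P + 0 * Q dvd Q" by simp
    then show ?thesis by blast
  next
    case False
    then have "euclidean_size (P mod Q) < euclidean_size Q"
      by (rule mod_size_less)
    then obtain A B where AB: "A * Q + B * (P mod Q) dvd Q" "A * Q + B * (P mod Q) dvd P mod Q"
      using less by blast
    have eq: "A * Q + B * (P mod Q) = B * P + (A - B * (P div Q)) * Q"
      by (simp add: minus_div_mult_eq_mod [symmetric] algebra_simps)
    have "A * Q + B * (P mod Q) dvd P"
      using AB by (rule dvd_mod_imp_dvd [rotated])
    then show ?thesis using AB unfolding eq by blast
  qed
qed

lemma poly_coprime_dvd_mult:
  fixes P Q R :: "'a::field poly"
  assumes "coprime P Q" and "Q dvd P * R"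
  shows "Q dvd R"
proof -
  obtain A B where AB: "A * P + B * Q dvd P" "A * P + B * Q dvd Q"
    using poly_bezout by blast
  then have "is_unit (A * P + B * Q)"
    using assms(1) by (blast dest: coprime_common_divisor)
  then obtain U where U: "1 = (A * P + B * Q) * U" by (elim dvdE)
  have "R = ((A * P + B * Q) * U) * R" using U by simp
  also have "\<dots> = A * U * (P * R) + Q * (B * U * R)" by (simp add: algebra_simps)
  finally have "R = A * U * (P * R) + Q * (B * U * R)" .
  moreover have "Q dvd A * U * (P * R) + Q * (B * U * R)" using assms(2) by simp
  ultimately show ?thesis by simp
qed

lemma ex_coprime_quot:
  fixes f :: "'a::field poly fract"
  obtains P Q where "Q \<noteq> 0" and "coprime P Q" and "f = Fract P Q"
proof -
  obtain P Q where PQ: "f = Fract P Q" "Q \<noteq> 0" by (cases f) auto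
  obtain A B where AB: "A * P + B * Q dvd P" "A * P + B * Q dvd Q"
    using poly_bezout by blast
  define D where "D = A * P + B * Q"
  obtain P' Q' where P': "P = D * P'" and Q': "Q = D * Q'"
    using AB unfolding D_def by (elim dvdE)
  have nz: "D \<noteq> 0" "Q' \<noteq> 0" using PQ(2) Q' by auto
  have "D * (A * P' + B * Q') = D * 1"
    using D_def P' Q' by (simp add: algebra_simps)
  then have one: "A * P' + B * Q' = 1" using nz(1) mult_left_cancel by blast
  have "coprime P' Q'"
  proof (rule coprimeI)
    fix C assume "C dvd P'" "C dvd Q'"
    then have "C dvd A * P' + B * Q'" by simp
    then show "is_unit C" using one by simp
  qed
  moreover have "f = Fract P' Q'"
    using PQ nz by (simp add: P' Q' eq_fract)
  ultimately show thesis using that nz by blast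
qed

lemma quot_map_unique:
  fixes P Q P' Q' :: "'a::field poly"
  assumes "Q \<noteq> 0" "coprime P Q" "Q' \<noteq> 0" "coprime P' Q'" and eq: "Fract P Q = Fract P' Q'"
  shows "quot_map P Q = quot_map P' Q'"
proof -
  have cross: "P * Q' = P' * Q" using eq assms by (simp add: eq_fract)
  have "Q dvd Q'" using assms(2) cross by (metis dvd_triv_right poly_coprime_dvd_mult)
  moreover have "Q' dvd Q" using assms(4) cross by (metis dvd_triv_right poly_coprime_dvd_mult)
  ultimately obtain C D where C: "Q' = Q * C" and D: "Q = Q' * D"
    by (elim dvdE)
  have "Q * (C * D) = Q * 1" using C D by (metis mult.assoc mult.right_neutral)
  then have "C * D = 1" using assms(1) mult_left_cancel by blast
  then have "is_unit C" by (metis dvd_triv_left)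
  then obtain c where c: "C = [:c:]" by (auto simp: is_unit_poly_iff)
  have "c \<noteq> 0" using c C assms(3) by auto
  have Q': "Q' = smult c Q" using C c by (simp add: mult.commute)
  have "Q * P' = Q * smult c P" using cross by (simp add: Q' mult.commute)
  then have P': "P' = smult c P" using assms(1) mult_left_cancel by blast
  show ?thesis
    using \<open>c \<noteq> 0\<close> by (auto simp: fun_eq_iff quot_map_def P' Q' split: proj_line.split)
qed

lemma ratfun_map_Fract:
  assumes "Q \<noteq> 0" and "coprime P Q"
  shows "ratfun_map (Fract P Q) = quot_map P Q"
  unfolding ratfun_map_def
proof (rule the_equality)
  show "\<exists>P' Q'. Q' \<noteq> 0 \<and> coprime P' Q' \<and> Fract P Q = Fract P' Q' \<and> quot_map P Q = quot_map P' Q'"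
    using assms by blast
next
  fix g
  assume "\<exists>P' Q'. Q' \<noteq> 0 \<and> coprime P' Q' \<and> Fract P Q = Fract P' Q' \<and> g = quot_map P' Q'"
  then obtain P' Q' where *: "Q' \<noteq> 0" "coprime P' Q'" "Fract P Q = Fract P' Q'" "g = quot_map P' Q'"
    by blast
  show "g = quot_map P Q"
    unfolding *(4) using quot_map_unique [OF assms *(1-3)] by simp
qed

end

theory Submission
  imports Defs
begin

text \<open>
  In characteristic 2 put \<open>t = r + r^q\<close> and \<open>N = r^(q+1)\<close>; both lie in \<open>K\<close>, and
  \<open>f = X + t / (X^2 + t X + N)\<close> fixes infinity and has no pole in \<open>K\<close>, so everything depends on
  injectivity on \<open>K\<close>. The set \<open>T = {u^2 + u}\<close> (the elements of trace 0) is an additive subgroup of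
  \<open>K\<close> of index 2, and \<open>N / t^2 \<notin> T\<close> since the denominator has no root in \<open>K\<close>. Writing
  \<open>x = t u\<close>, \<open>y = t v\<close>, \<open>A = u^2 + u + N / t^2\<close> and \<open>s = u + v + 1\<close>, a collision
  \<open>f(x) = f(y)\<close> with \<open>x \<noteq> y\<close> amounts to a solution of \<open>t^2 A (A + s^2 + s) = s\<close> with
  \<open>A \<notin> T\<close> and \<open>s \<noteq> 1\<close>. This is a quadratic equation in \<open>s\<close>, solvable according to membership in
  \<open>T\<close>. For \<open>t = 1\<close> solvability forces \<open>A \<in> T\<close>. For \<open>t \<noteq> 1\<close> a suitable \<open>A\<close> is either \<open>1 / t^2\<close>, or
  comes from an \<open>x\<close> with \<open>x \<notin> T\<close> and \<open>h / x \<notin> T\<close> for a certain \<open>h \<noteq> 0\<close>. Such an \<open>x\<close> exists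
  because \<open>x \<mapsto> h / x\<close> cannot inject the complement of \<open>T\<close> into \<open>T - {0}\<close>, which is smaller.
\<close>

section \<open>Finite subfields and power maps\<close>

lemma subfield_closed:
  assumes "is_subfield K"
  shows "0 \<in> K" "1 \<in> K"
    and "x \<in> K \<Longrightarrow> y \<in> K \<Longrightarrow> x - y \<in> K"
    and "x \<in> K \<Longrightarrow> - x \<in> K"
    and "x \<in> K \<Longrightarrow> y \<in> K \<Longrightarrow> x + y \<in> K"
    and "x \<in> K \<Longrightarrow> y \<in> K \<Longrightarrow> x * y \<in> K"
    and "x \<in> K \<Longrightarrow> inverse x \<in> K"
    and "x \<in> K \<Longrightarrow> y \<in> K \<Longrightarrow> x / y \<in> K"
    and "x \<in> K \<Longrightarrow> x ^ k \<in> K"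
proof -
  show 0: "0 \<in> K" and 1: "1 \<in> K"
    and diff: "\<And>x y. x \<in> K \<Longrightarrow> y \<in> K \<Longrightarrow> x - y \<in> K"
    and mult: "\<And>x y. x \<in> K \<Longrightarrow> y \<in> K \<Longrightarrow> x * y \<in> K"
    and inv: "\<And>x. x \<in> K \<Longrightarrow> inverse x \<in> K"
    using assms by (auto simp: is_subfield_def)
  show uminus: "- x \<in> K" if "x \<in> K" for x using diff [OF 0 that] by simp
  show "x + y \<in> K" if "x \<in> K" "y \<in> K" for x y
    using diff [OF that(1) uminus [OF that(2)]] by simp
  show "x / y \<in> K" if "x \<in> K" "y \<in> K" for x y
    using mult [OF that(1) inv [OF that(2)]] by (simp add: divide_inverse)
  show "x ^ k \<in> K" if "x \<in> K" for x k
    by (induction k) (use that 1 mult in auto)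
qed

text \<open>Multiplication by a nonzero \<open>x\<close> permutes the nonzero elements of
  \<open>K\<close>; comparing the products over them gives
  \<open>x ^ (card K - 1) = 1\<close>.\<close>

lemma finite_subfield_power_card:
  fixes K :: "'a::field set"
  assumes K: "is_subfield K" and "finite K" and "x \<in> K"
  shows "x ^ card K = x"
proof (cases "x = 0")
  case True
  have "card K > 0" using assms subfield_closed(1) [OF K] by (auto simp: card_gt_0_iff)
  with True show ?thesis by simp
next
  case False
  let ?U = "K - {0}"
  have "bij_betw ((*) x) ?U ?U"
  proof (rule bij_betwI [where g = "\<lambda>y. y / x"])
    show "(*) x \<in> ?U \<rightarrow> ?U" "(\<lambda>y. y / x) \<in> ?U \<rightarrow> ?U"
      using False assms(3) subfield_closed [OF K] by auto
  qed (use False in auto)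
  then have "(\<Prod>y\<in>?U. x * y) = \<Prod>?U"
    by (rule prod.reindex_bij_betw)
  then have "x ^ card ?U * \<Prod>?U = 1 * \<Prod>?U"
    by (simp add: prod.distrib)
  moreover have "\<Prod>?U \<noteq> 0" using assms(2) by simp
  ultimately have "x ^ card ?U = 1" by simp
  moreover have "card K = Suc (card ?U)"
    using assms(2) subfield_closed(1) [OF K] by (metis card.remove)
  ultimately show ?thesis by simp
qed

text \<open>The polynomial X^q - X with \<open>q = card K\<close> has at most \<open>q\<close>
  roots, and \<open>K\<close> already supplies that many.\<close>

lemma finite_subfield_iff_power_card:
  fixes K :: "'a::field set"
  assumes K: "is_subfield K" and "finite K"
  shows "x \<in> K \<longleftrightarrow> x ^ card K = x"
proof -
  let ?p = "monom 1 (card K) - monom 1 1 :: 'a poly"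
  have "card {0, 1 :: 'a} \<le> card K"
    using assms subfield_closed(1,2) [OF K] by (intro card_mono) auto
  then have gt: "card K > 1" by simp
  have "coeff ?p (card K) = 1" using gt by simp
  then have nz: "?p \<noteq> 0" by (metis coeff_0 zero_neq_one)
  have "degree ?p \<le> card K"
    using gt by (intro degree_diff_le) (auto simp: degree_monom_eq)
  have "card {x. poly ?p x = 0} \<le> card K"
    using card_poly_roots_bound [OF nz] \<open>degree ?p \<le> card K\<close> by linarith
  moreover have "K \<subseteq> {x. poly ?p x = 0}"
    using finite_subfield_power_card [OF assms] by (auto simp: poly_monom)
  ultimately have "K = {x. poly ?p x = 0}"
    using poly_roots_finite [OF nz] card_seteq by blast
  then show ?thesis by (auto simp: poly_monom)
qed

section \<open>Characteristic 2 and the image of the Artin-Schreier map\<close>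

locale binary_subfield =
  fixes K :: "'a::field set"
  assumes subfield: "is_subfield K" and finite_K: "finite K" and two_eq_0: "(1::'a) + 1 = 0"
begin

lemmas closed = subfield_closed [OF subfield]

lemma add_self [simp]: "x + x = (0::'a)"
  using two_eq_0 by (metis distrib_left mult.right_neutral mult_zero_right)

lemma add_self_left [simp]: "x + (x + y) = (y::'a)"
  by (simp add: add.assoc [symmetric])

lemma uminus_eq [simp]: "- x = (x::'a)"
  using add_self [of x] by (rule minus_unique)

lemma add_eq_0_iff_eq [simp]: "x + y = 0 \<longleftrightarrow> x = (y::'a)"
  by (metis add_eq_0_iff uminus_eq)

lemma square_add: "(x + y)\<^sup>2 = x\<^sup>2 + (y::'a)\<^sup>2"
  by (simp add: power2_eq_square algebra_simps)

text \<open>Iterated squaring. It makes the \<open>q\<close>-power map additive, which later puts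
  \<open>r + r ^ q\<close> into \<open>K\<close>.\<close>

lemma frobenius_add: "(x + y) ^ 2 ^ n = x ^ 2 ^ n + (y::'a) ^ 2 ^ n"
  by (induction n) (simp_all add: power_mult power2_eq_square [symmetric] square_add mult.commute [of 2])

lemma square_eq_iff [simp]: "x\<^sup>2 = y\<^sup>2 \<longleftrightarrow> x = (y::'a)"
  by (metis add_eq_0_iff_eq power_eq_0_iff square_add zero_less_numeral power2_eq_square mult_eq_0_iff)

text \<open>The image of the Artin--Schreier map, that is, the elements of absolute trace 0.\<close>

definition AS :: "'a set" where
  "AS = (\<lambda>u. u\<^sup>2 + u) ` K"

lemma AS_I: "u \<in> K \<Longrightarrow> a = u\<^sup>2 + u \<Longrightarrow> a \<in> AS"
  unfolding AS_def by blast

lemma AS_E: assumes "a \<in> AS" obtains u where "u \<in> K" "a = u\<^sup>2 + u"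
  using assms unfolding AS_def by blast

lemma AS_subset: "AS \<subseteq> K"
  by (auto simp: AS_def closed)

lemma finite_AS: "finite AS"
  by (simp add: AS_def finite_K)

lemma zero_in_AS: "0 \<in> AS"
  by (rule AS_I [of 0]) (auto simp: closed)

lemma AS_add: assumes "a \<in> AS" "b \<in> AS" shows "a + b \<in> AS"
proof -
  obtain u v where "u \<in> K" "v \<in> K" "a = u\<^sup>2 + u" "b = v\<^sup>2 + v"
    using assms by (elim AS_E) blast
  then show ?thesis
    by (intro AS_I [of "u + v"]) (auto simp: closed square_add add_ac)
qed

lemma AS_add_iff: "a \<in> AS \<Longrightarrow> a + b \<in> AS \<longleftrightarrow> b \<in> AS"
  using AS_add [of a b] AS_add [of a "a + b"] by auto

lemma AS_square_iff: assumes "a \<in> K" shows "a\<^sup>2 \<in> AS \<longleftrightarrow> a \<in> AS"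
proof -
  have "a\<^sup>2 + a \<in> AS" using assms by (blast intro: AS_I)
  then show ?thesis by (metis AS_add_iff add.commute)
qed

text \<open>The map u^2 + u is two-to-one on \<open>K\<close>: its fibres have the form
  \<open>{u, u + 1}\<close>.\<close>

lemma card_K_eq: "card K = 2 * card AS"
proof -
  have fibre: "card {v \<in> K. v\<^sup>2 + v = a} = 2" if a: "a \<in> AS" for a
  proof -
    obtain u where u: "u \<in> K" "a = u\<^sup>2 + u" using a by (rule AS_E)
    have "v = u \<or> v = u + 1" if "v\<^sup>2 + v = u\<^sup>2 + u" for v
    proof -
      have "(v + u) * (v + u + 1) = (v\<^sup>2 + v) + (u\<^sup>2 + u) + (v * u + v * u)"
        by (simp add: power2_eq_square algebra_simps)
      then have "(v + u) * (v + u + 1) = 0" using that by simp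
      then show ?thesis by (metis add_eq_0_iff_eq add.assoc mult_eq_0_iff)
    qed
    then have "{v \<in> K. v\<^sup>2 + v = a} = {u, u + 1}"
      using u by (auto simp: closed square_add add_ac)
    then show ?thesis by simp
  qed
  have "K = (\<Union>a\<in>AS. {v \<in> K. v\<^sup>2 + v = a})"
    by (auto intro: AS_I)
  then have "card K = card (\<Union>a\<in>AS. {v \<in> K. v\<^sup>2 + v = a})" by simp
  also have "\<dots> = (\<Sum>a\<in>AS. card {v \<in> K. v\<^sup>2 + v = a})"
    by (rule card_UN_disjoint) (auto simp: finite_AS finite_K)
  also have "\<dots> = 2 * card AS" using fibre by simp
  finally show ?thesis .
qed

lemma card_compl_AS: "card (K - AS) = card AS"
  using card_K_eq by (simp add: card_Diff_subset finite_AS AS_subset)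

text \<open>The coset of \<open>AS\<close> through \<open>a\<close> lies in the complement and has
  the same size, so it is the whole complement and contains \<open>b\<close>.\<close>

lemma compl_AS_add:
  assumes "a \<in> K - AS" "b \<in> K - AS"
  shows "a + b \<in> AS"
proof -
  have "(+) a ` AS \<subseteq> K - AS"
    using assms AS_subset AS_add_iff by (auto simp: closed add.commute)
  moreover have "card ((+) a ` AS) = card (K - AS)"
    by (simp add: card_compl_AS card_image)
  ultimately have "(+) a ` AS = K - AS"
    using finite_K by (intro card_seteq) auto
  then obtain c where "c \<in> AS" "b = a + c" using assms by blast
  then show ?thesis by simp
qed

lemma ex_compl_AS_divide:
  assumes "h \<in> K" "h \<noteq> 0"
  obtains x where "x \<in> K - AS" "h / x \<in> K - AS"
proof (rule ccontr)
  assume *: "\<not> thesis"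
  have "(\<lambda>x. h / x) ` (K - AS) \<subseteq> AS - {0}"
  proof
    fix y assume "y \<in> (\<lambda>x. h / x) ` (K - AS)"
    then obtain x where x: "x \<in> K - AS" "y = h / x" by blast
    then have "x \<noteq> 0" using zero_in_AS by auto
    moreover have "h / x \<in> K" using x assms by (auto intro: closed)
    ultimately show "y \<in> AS - {0}" using * that x assms by auto
  qed
  moreover have "inj_on (\<lambda>x. h / x) (K - AS)"
  proof (rule inj_onI)
    fix x y assume "x \<in> K - AS" "y \<in> K - AS" "h / x = h / y"
    then show "x = y" using assms zero_in_AS by (auto simp: field_simps)
  qed
  ultimately have "card (K - AS) \<le> card (AS - {0})"
    using finite_AS by (metis card_inj_on_le finite_Diff)
  \<comment> \<open>The value 0 in \<open>AS\<close> is never a quotient \<open>h / x\<close>; this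
    one missing value makes the count strict.\<close>
  also have "\<dots> < card AS"
    using zero_in_AS finite_AS by (metis card_Diff1_less)
  finally show False by (simp add: card_compl_AS)
qed


section \<open>Collisions as solutions of a quadratic equation\<close>

lemma collision_iff:
  fixes t N :: 'a
  defines "D \<equiv> \<lambda>x. x\<^sup>2 + t * x + N"
  assumes t: "t \<in> K" "t \<noteq> 0" and N: "N \<in> K" and no_root: "\<And>x. x \<in> K \<Longrightarrow> D x \<noteq> 0"
  shows "\<not> inj_on (\<lambda>x. x + t / D x) K \<longleftrightarrow>
    (\<exists>A s. A \<in> K - AS \<and> s \<in> K \<and> s \<noteq> 1 \<and> t\<^sup>2 * A * (A + s\<^sup>2 + s) = s)"
proof -
  have D_scaled: "D (t * u) = t\<^sup>2 * (u\<^sup>2 + u + N / t\<^sup>2)" for u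
    using t by (simp add: D_def field_simps power2_eq_square)
  \<comment> \<open>In characteristic 2, \<open>s + 1\<close> and \<open>s\<close> have the same
    image under the Artin-Schreier map.\<close>
  have D_shift: "D (t * (u + s + 1)) = D (t * u) + t\<^sup>2 * (s\<^sup>2 + s)" for u s
    by (simp only: D_def power_mult_distrib square_add) (simp add: algebra_simps power2_eq_square)
  have eq_iff: "t * u + t / D (t * u) = t * v + t / D (t * v) \<longleftrightarrow>
      u = v \<or> D (t * u) * D (t * v) = t\<^sup>2 * (u + v + 1)"
    if "u \<in> K" "v \<in> K" for u v
  proof -
    have nz: "D (t * u) \<noteq> 0" "D (t * v) \<noteq> 0" using that t no_root by (auto simp: closed)
    \<comment> \<open>The constant \<open>N\<close> cancels, and the factor \<open>u + v\<close>
      that accounts for the trivial solution \<open>u = v\<close> splits off.\<close>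
    have dd: "D (t * v) + D (t * u) = t\<^sup>2 * ((u + v) * (u + v + 1))"
      by (simp add: D_def algebra_simps power2_eq_square)
    have "t * u + t / D (t * u) = t * v + t / D (t * v) \<longleftrightarrow>
      t * u + t / D (t * u) + (t * v + t / D (t * v)) = 0" by simp
    also have "t * u + t / D (t * u) + (t * v + t / D (t * v)) =
      t * ((u + v) + (D (t * v) + D (t * u)) / (D (t * u) * D (t * v)))"
      using nz by (simp add: field_simps)
    also have "\<dots> = t * (u + v) * (D (t * u) * D (t * v) + t\<^sup>2 * (u + v + 1)) / (D (t * u) * D (t * v))"
      unfolding dd using nz by (simp add: field_simps)
    finally show ?thesis using nz t by simp
  qed
  have M: "N / t\<^sup>2 \<in> K - AS"
  proof
    show "N / t\<^sup>2 \<in> K" using N t by (simp add: closed)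
    show "N / t\<^sup>2 \<notin> AS"
    proof
      assume "N / t\<^sup>2 \<in> AS"
      then obtain u where "u \<in> K" "N / t\<^sup>2 = u\<^sup>2 + u" by (rule AS_E)
      then have "D (t * u) = 0" unfolding D_scaled by simp
      then show False using no_root \<open>u \<in> K\<close> t by (simp add: closed)
    qed
  qed
  show ?thesis
  proof
    assume "\<not> inj_on (\<lambda>x. x + t / D x) K"
    then obtain x y where xy: "x \<in> K" "y \<in> K" "x \<noteq> y" "x + t / D x = y + t / D y"
      by (auto simp: inj_on_def)
    define u v where "u = x / t" and "v = y / t"
    have uv: "u \<in> K" "v \<in> K" "u \<noteq> v" "x = t * u" "y = t * v"
      using xy t by (auto simp: u_def v_def closed)
    define A where "A = u\<^sup>2 + u + N / t\<^sup>2"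
    define s where "s = u + v + 1"
    have v: "v = u + s + 1" by (simp add: s_def add_ac)
    have "D (t * u) * D (t * v) = t\<^sup>2 * s"
      using eq_iff [of u v] uv xy(4) by (simp add: s_def)
    moreover have "D (t * v) = t\<^sup>2 * (A + s\<^sup>2 + s)"
      unfolding v D_shift unfolding D_scaled A_def by (simp add: algebra_simps)
    ultimately have "t\<^sup>2 * (t\<^sup>2 * A * (A + s\<^sup>2 + s)) = t\<^sup>2 * s"
      unfolding D_scaled A_def by (simp add: mult_ac)
    then have "t\<^sup>2 * A * (A + s\<^sup>2 + s) = s" using t by simp
    moreover have "A \<in> K - AS"
    proof -
      have "u\<^sup>2 + u \<in> AS" using uv by (blast intro: AS_I)
      then have "A \<notin> AS" using M AS_add_iff unfolding A_def by blast
      then show ?thesis using uv M by (simp add: A_def closed)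
    qed
    moreover have "s \<in> K" "s \<noteq> 1" using uv by (auto simp: s_def closed)
    ultimately show "\<exists>A s. A \<in> K - AS \<and> s \<in> K \<and> s \<noteq> 1 \<and> t\<^sup>2 * A * (A + s\<^sup>2 + s) = s"
      by blast
  next
    assume "\<exists>A s. A \<in> K - AS \<and> s \<in> K \<and> s \<noteq> 1 \<and> t\<^sup>2 * A * (A + s\<^sup>2 + s) = s"
    then obtain A s where As: "A \<in> K - AS" "s \<in> K" "s \<noteq> 1" "t\<^sup>2 * A * (A + s\<^sup>2 + s) = s"
      by blast
    \<comment> \<open>The substitution is reversible: since \<open>AS\<close> has index 2, every
      \<open>A\<close> outside it arises from some \<open>u\<close>.\<close>
    have "A + N / t\<^sup>2 \<in> AS" using compl_AS_add As(1) M by blast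
    then obtain u where u: "u \<in> K" "A + N / t\<^sup>2 = u\<^sup>2 + u" by (rule AS_E)
    define v where "v = u + s + 1"
    have v: "v \<in> K" "u \<noteq> v" "u + v + 1 = s"
      using u As(2,3) by (auto simp: v_def closed add.assoc)
    have Du: "D (t * u) = t\<^sup>2 * A" unfolding D_scaled u(2) [symmetric] by (simp add: add.assoc)
    have Dv: "D (t * v) = t\<^sup>2 * (A + s\<^sup>2 + s)"
      unfolding v_def D_shift Du by (simp add: algebra_simps)
    have "D (t * u) * D (t * v) = t\<^sup>2 * (t\<^sup>2 * A * (A + s\<^sup>2 + s))"
      unfolding Du Dv by (simp add: mult_ac)
    then have "D (t * u) * D (t * v) = t\<^sup>2 * (u + v + 1)" by (simp add: As(4) v(3))
    then have "t * u + t / D (t * u) = t * v + t / D (t * v)"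
      using eq_iff u(1) v(1) by blast
    then show "\<not> inj_on (\<lambda>x. x + t / D x) K"
      using u(1) v(1,2) t unfolding inj_on_def
      by (metis closed(6) mult_left_cancel)
  qed
qed

text \<open>For \<open>A = 1\<close> the linear term vanishes and only \<open>s = 1\<close> is left.
  Otherwise \<open>y = A * s / (A + 1)\<close> normalizes the quadratic to y^2 + y = A^3 / (A +
  1)^2, and the right side differs from \<open>A\<close> by c^2 + c with
  \<open>c = 1 / (A + 1)\<close>.\<close>

lemma no_collision_one:
  assumes A: "A \<in> K - AS" and s: "s \<in> K" "s \<noteq> 1" and eq: "A * (A + s\<^sup>2 + s) = s"
  shows False
proof (cases "A = 1")
  case True
  with eq have "(1 + s\<^sup>2) + s = s" by simp
  then have "1\<^sup>2 = s\<^sup>2" by simp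
  then show False using s by (simp only: square_eq_iff) simp
next
  case False
  then have nz: "A + 1 \<noteq> 0" by simp
  \<comment> \<open>This is \<open>y + c\<close>, so its Artin-Schreier image is
    \<open>A\<close>.\<close>
  define w where "w = (A * s + 1) / (A + 1)"
  have "A * (A * (A + s\<^sup>2 + s)) = A * s" by (simp only: eq)
  then have *: "A * s = A^3 + A\<^sup>2 * s\<^sup>2 + A\<^sup>2 * s"
    by (simp add: algebra_simps power2_eq_square power3_eq_cube)
  have "(A * s + 1)\<^sup>2 + (A * s + 1) * (A + 1) = A\<^sup>2 * s\<^sup>2 + A\<^sup>2 * s + A * s + A"
    by (simp add: algebra_simps power2_eq_square)
  also have "\<dots> = A * (A + 1)\<^sup>2"
    unfolding * by (simp add: algebra_simps power2_eq_square power3_eq_cube)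
  finally have "A = ((A * s + 1)\<^sup>2 + (A * s + 1) * (A + 1)) / (A + 1)\<^sup>2"
    using nz by simp
  also have "\<dots> = w\<^sup>2 + w"
    unfolding w_def power_divide add_divide_distrib [of "_\<^sup>2"] using nz
    by (simp add: power2_eq_square)
  finally have "A \<in> AS"
    using A s by (intro AS_I [of w]) (auto simp: w_def closed)
  with A show False by blast
qed

lemma ex_collision_not_one:
  assumes t: "t \<in> K" "t \<noteq> 0" "t \<noteq> 1"
  shows "\<exists>A s. A \<in> K - AS \<and> s \<in> K \<and> s \<noteq> 1 \<and> t\<^sup>2 * A * (A + s\<^sup>2 + s) = s"
proof -
  define d where "d = 1 / t"
  define e where "e = d\<^sup>2"
  have d: "d \<in> K" "d \<noteq> 0" "d \<noteq> 1" using t by (auto simp: d_def closed)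
  have te: "t\<^sup>2 * e = 1" using t by (simp add: e_def d_def power_divide)
  have e: "e \<in> K" "e \<noteq> 0" using d by (auto simp: e_def closed)
  show ?thesis
  proof (cases "e \<in> AS")
    case False
    \<comment> \<open>The solution is \<open>A = e\<close>, \<open>s = d\<close>: the bracket
      collapses to \<open>d\<close> because e = d^2.\<close>
    have "t\<^sup>2 * e * (e + d\<^sup>2 + d) = d" using te by (simp add: e_def)
    then show ?thesis using False e d by blast
  next
    case True
    then have d_AS: "d \<in> AS" using AS_square_iff d unfolding e_def by blast
    \<comment> \<open>With b = t^2 A + 1 the coefficient of \<open>s\<close>, the substitution
      \<open>s = b * z / (t^2 * A)\<close> gives z^2 + z = e (b + 1)^3 / b^2 = A + e/b + e/b^2.
      Since g^2 = e^2 + e, this is A + (g/b)^2 plus the Artin-Schreier image of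
      \<open>e / b\<close>. So it suffices that \<open>A\<close> and \<open>g / b\<close> both avoid
      \<open>AS\<close>.\<close>
    define g where "g = e + d"
    have "g = d * (d + 1)" by (simp add: g_def e_def power2_eq_square algebra_simps)
    then have g: "g \<in> K" "g \<noteq> 0" using d by (auto simp: closed)
    obtain x where x: "x \<in> K - AS" "g * e / x \<in> K - AS"
      using ex_compl_AS_divide [of "g * e"] g e by (auto simp: closed)
    then have x0: "x \<noteq> 0" using zero_in_AS by auto
    define b where "b = t\<^sup>2 * x"
    have b: "b \<in> K" "b \<noteq> 0" using x t x0 by (auto simp: b_def closed)
    have eb: "e * b = x" using te by (simp add: b_def mult.assoc [symmetric] mult.commute [of e])
    \<comment> \<open>As \<open>e\<close> is in \<open>AS\<close>, the condition on \<open>A\<close>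
      becomes one on \<open>x = e * b\<close>, while \<open>g / b\<close> equals
      \<open>g * e / x\<close>.\<close>
    define A where "A = x + e"
    have "A \<notin> AS" using AS_add_iff [OF True, of x] x(1) by (simp add: A_def add.commute)
    then have A: "A \<in> K - AS" using x(1) e(1) by (simp add: A_def closed)
    then have A0: "A \<noteq> 0" using zero_in_AS by auto
    have tA: "t\<^sup>2 * A = b + 1" by (simp add: A_def distrib_left te b_def)
    have Aeb: "A = e * (b + 1)" by (simp add: A_def distrib_left eb)
    have gb: "g * e / x = g / b" using e by (simp add: eb [symmetric])
    have "(g / b)\<^sup>2 \<in> K - AS"
      using x(2) AS_square_iff [of "g / b"] unfolding gb by (auto simp: closed)
    then have "A + (g / b)\<^sup>2 \<in> AS" using compl_AS_add A by blast
    moreover have "(e / b)\<^sup>2 + e / b \<in> AS" using e b by (intro AS_I [of "e / b"]) (auto simp: closed)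
    ultimately have "A + (g / b)\<^sup>2 + ((e / b)\<^sup>2 + e / b) \<in> AS" by (rule AS_add)
    then obtain z where z: "z \<in> K" "A + (g / b)\<^sup>2 + ((e / b)\<^sup>2 + e / b) = z\<^sup>2 + z"
      by (rule AS_E)
    have g2: "g\<^sup>2 = e\<^sup>2 + e" unfolding g_def square_add by (simp add: e_def)
    have "b\<^sup>2 * (z\<^sup>2 + z) = b\<^sup>2 * A + g\<^sup>2 + (e\<^sup>2 + e * b)"
      unfolding z(2) [symmetric] using b by (simp add: field_simps power2_eq_square)
    also have "\<dots> = e * (b + 1) * (b + 1)\<^sup>2"
      unfolding g2 Aeb by (simp add: algebra_simps power2_eq_square)
    finally have bz: "b\<^sup>2 * (z\<^sup>2 + z) = A * (t\<^sup>2 * A)\<^sup>2"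
      unfolding tA by (simp add: Aeb)
    define s where "s = b * z / (t\<^sup>2 * A)"
    have tAs: "t\<^sup>2 * A * s = b * z" using A0 t by (simp add: s_def)
    have "(t\<^sup>2 * A) * (t\<^sup>2 * A * (A + s\<^sup>2 + s) + s) =
        A * (t\<^sup>2 * A)\<^sup>2 + (t\<^sup>2 * A * s)\<^sup>2 + (t\<^sup>2 * A * s) * (t\<^sup>2 * A + 1)"
      by (simp add: algebra_simps power2_eq_square)
    also have "\<dots> = A * (t\<^sup>2 * A)\<^sup>2 + b\<^sup>2 * (z\<^sup>2 + z)"
      unfolding tAs unfolding tA by (simp add: algebra_simps power2_eq_square)
    also have "\<dots> = 0" by (simp add: bz)
    finally have eq: "t\<^sup>2 * A * (A + s\<^sup>2 + s) = s" using A0 t by simp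
    \<comment> \<open>The value \<open>s = 1\<close> would force \<open>A = d\<close>, but
      \<open>d\<close> is in \<open>AS\<close>.\<close>
    have "s \<noteq> 1"
    proof
      assume "s = 1"
      with eq have "(t * A)\<^sup>2 = 1\<^sup>2" by (simp add: add.assoc power2_eq_square mult_ac)
      then have "t * A = 1" by (simp only: square_eq_iff)
      then have "A = d" using t by (simp add: d_def field_simps)
      with A d_AS show False by blast
    qed
    moreover have "s \<in> K" using b z t A by (auto simp: s_def closed)
    ultimately show ?thesis using A eq by blast
  qed
qed

lemma inj_on_iff_one:
  assumes "t \<in> K" "t \<noteq> 0" "N \<in> K" "\<And>x. x \<in> K \<Longrightarrow> x\<^sup>2 + t * x + N \<noteq> 0"
  shows "inj_on (\<lambda>x. x + t / (x\<^sup>2 + t * x + N)) K \<longleftrightarrow> t = 1"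
proof (cases "t = 1")
  case True
  then show ?thesis
    using collision_iff [OF assms] no_collision_one by auto
next
  case False
  then show ?thesis
    using collision_iff [OF assms] ex_collision_not_one [OF assms(1,2)] by blast
qed

end

section \<open>Reduction of the theorem to injectivity on \<open>K\<close>\<close>

theorem theorem3p2:
  fixes q n :: nat
    and K :: "'a::{finite, field} set"
    and r :: 'a
    and f :: "'a poly fract"
  assumes "n > 0" and "q = 2 ^ n"
    and "CARD('a) = q ^ 2"
    and "is_subfield K" and "card K = q"
    and "r \<notin> K"
    and "f = to_fract [:0, 1:] + 1 / to_fract [:- r, 1:] + 1 / to_fract [:- (r ^ q), 1:]"
  shows "f \<in> ratfuns_over K \<and> (permutation_ratfun K f \<longleftrightarrow> r + r ^ q = 1)"
proof -
  \<comment> \<open>Characteristic 2 follows from evaluating the even power \<open>(-1) ^ q\<close>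
    in two ways.\<close>
  have "(-1::'a) \<in> K" using subfield_closed [OF assms(4)] by blast
  then have "(-1::'a) ^ q = -1"
    using finite_subfield_power_card [OF assms(4)] assms(5) by simp
  moreover have "even q" using assms(1,2) by simp
  ultimately have "(1::'a) = - 1" by simp
  then have "(1::'a) + 1 = 0" by (metis add.right_inverse)
  then interpret binary_subfield K
    by unfold_locales (use assms(4) in auto)
  have K_iff: "x \<in> K \<longleftrightarrow> x ^ q = x" for x
    using finite_subfield_iff_power_card [OF assms(4)] assms(5) by simp
  \<comment> \<open>The whole field is taken as a subfield of itself, so the \<open>q\<close>-power
    map is an involution.\<close>
  have "r ^ CARD('a) = r"
    by (rule finite_subfield_power_card) (auto simp: is_subfield_def)
  then have rqq: "(r ^ q) ^ q = r"
    by (simp add: assms(3) power_mult [symmetric] power2_eq_square)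
  have rq: "r ^ q \<noteq> r" "r ^ q \<notin> K" using rqq assms(6) K_iff by auto
  define t where "t = r + r ^ q"
  define N where "N = r * r ^ q"
  have t: "t \<in> K" "t \<noteq> 0"
    using rq frobenius_add [of r "r ^ q" n] rqq
    by (auto simp: t_def K_iff assms(2) add.commute)
  have N: "N \<in> K"
    by (simp add: N_def K_iff power_mult_distrib rqq mult.commute)
  have D: "x\<^sup>2 + t * x + N = (x + r) * (x + r ^ q)" for x
    by (simp add: t_def N_def algebra_simps power2_eq_square)
  have no_root: "x\<^sup>2 + t * x + N \<noteq> 0" if "x \<in> K" for x
    using that rq assms(6) unfolding D by auto
  define Q where "Q = [:N, t, 1:]"
  define P where "P = [:0, 1:] * Q + [:t:]"
  have poly_Q: "poly Q x = x\<^sup>2 + t * x + N" for x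
    by (simp add: Q_def algebra_simps power2_eq_square)
  have poly_P: "poly P x = x * poly Q x + t" for x
    by (simp add: P_def)
  have "Q \<noteq> 0" by (simp add: Q_def)
  \<comment> \<open>A common divisor of \<open>P\<close> and \<open>Q\<close> divides P - X Q, the
    nonzero constant \<open>t\<close>.\<close>
  have "coprime P Q"
  proof (rule coprimeI)
    fix C assume "C dvd P" "C dvd Q"
    then have "C dvd P - [:0, 1:] * Q" by (meson dvd_diff dvd_mult)
    then have "C dvd [:t:]" by (simp add: P_def)
    moreover have "is_unit [:t:]" using t by (simp add: is_unit_pCons_iff)
    ultimately show "is_unit C" using dvd_trans by blast
  qed
  have Q_prod: "Q = [:- r, 1:] * [:- (r ^ q), 1:]"
    by (simp add: Q_def t_def N_def add.commute)
  have "f = Fract P Q"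
  proof -
    have "f = Fract [:0, 1:] 1 + Fract 1 [:- r, 1:] + Fract 1 [:- (r ^ q), 1:]"
      unfolding assms(7) to_fract_def One_fract_def by simp
    also have "\<dots> = Fract ([:0, 1:] * [:- r, 1:] * [:- (r ^ q), 1:] + [:- r, 1:] + [:- (r ^ q), 1:])
        ([:- r, 1:] * [:- (r ^ q), 1:])"
      by (simp add: algebra_simps del: uminus_eq)
    also have "\<dots> = Fract P Q"
      unfolding P_def Q_prod by (simp add: t_def add_ac)
    finally show ?thesis .
  qed
  have P: "P = [:t, N, t, 1:]" by (simp add: P_def Q_def)
  have "f \<in> ratfuns_over K"
    unfolding ratfuns_over_def
    using \<open>f = Fract P Q\<close> \<open>Q \<noteq> 0\<close> P t N closed(1,2)
    by (intro CollectI exI [of _ P] exI [of _ Q]) (auto simp: Q_def)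
  define h where "h = (\<lambda>x. x + t / (x\<^sup>2 + t * x + N))"
  have map: "ratfun_map f = quot_map P Q"
    using ratfun_map_Fract \<open>Q \<noteq> 0\<close> \<open>coprime P Q\<close> \<open>f = Fract P Q\<close> by blast
  have map_Infty: "ratfun_map f Infty = Infty"
    unfolding map by (simp add: quot_map_def P Q_def)
  have map_Affine: "ratfun_map f (Affine x) = Affine (h x)" if "x \<in> K" for x
    using no_root [OF that] unfolding map
    by (simp add: quot_map_def poly_P poly_Q h_def field_simps)
  have h_closed: "h x \<in> K" if "x \<in> K" for x
    using that t N by (simp add: h_def closed)
  have sub: "ratfun_map f ` proj_line_over K \<subseteq> proj_line_over K"
    using h_closed by (auto simp: proj_line_over_def map_Infty map_Affine)
  have "finite (proj_line_over K)" by (simp add: proj_line_over_def)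
  \<comment> \<open>An injective self-map of a finite set is onto.\<close>
  then have "bij_betw (ratfun_map f) (proj_line_over K) (proj_line_over K) \<longleftrightarrow>
      inj_on (ratfun_map f) (proj_line_over K)"
    using sub endo_inj_surj unfolding bij_betw_def by blast
  also have "\<dots> \<longleftrightarrow> inj_on h K"
    by (auto simp: inj_on_def proj_line_over_def map_Infty map_Affine)
  also have "\<dots> \<longleftrightarrow> t = 1"
    unfolding h_def by (rule inj_on_iff_one) (use t N no_root in auto)
  finally show ?thesis
    using \<open>f \<in> ratfuns_over K\<close> by (simp add: permutation_ratfun_def t_def)
qed

end
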